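(* For every integer $n\geq 1$ the following two polynomial identities hold: \[ \sum_{i=0}^{n}\sum_{j=0}^{\lfloor (n-i)/2\rfloor}\binom{n}{i}\binom{n-i}{j}\binom{n-j-i}{j}x^jy^i=\sum_{k=0}^{\lfloor n/2\rfloor}\binom{n}{2k}\binom{2k}{k}x^k(1+y)^{n-2k}, \] \[ \sum_{i=0}^{n}\sum_{j=0}^{\lfloor (n-i)/2\rfloor}\binom{n}{i}\binom{n-i}{j}\binom{n-j-i}{j}x^{2j}y^iz^{n-2j-i}=\sum_{k=0}^{n}\binom{n}{k}\binom{2k}{k}x^k(y+z-2x)^{n-k}. \] *)

theory Defs
  imports Complex_Main
begin

end

theory Submission
  imports Defs "HOL-Computational_Algebra.Polynomial"
begin

text \<open>
  Both double sums are values of the trinomial sum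
  \<open>T = \<Sum> n! / (j! j! i! (n-2j-i)!) x^j y^i z^(n-2j-i)\<close>; collecting the powers of \<open>y\<close> and \<open>z\<close> for
  fixed \<open>j\<close> gives the first identity.  For the second, put \<open>y + z = (y + z - 2x) + 2x\<close> and expand:
  the coefficients are evaluated by reading off \<open>t^m\<close> in
  \<open>(1 + t)^(2m) = ((1 + t^2) + 2t)^m\<close>.
\<close>

text \<open>Both sides equal \<open>(n choose (i + m)) * ((i + m) choose i)\<close>: disjoint sets
  of sizes \<open>i\<close> and \<open>m\<close> may be picked in either order.\<close>

lemma choose_mult_swap:
  assumes "i + m \<le> n"
  shows "(n choose i) * ((n - i) choose m) = (n choose m) * ((n - m) choose i)"
  using choose_mult[of i "i + m" n] choose_mult[of m "i + m" n]
    binomial_symmetric[of i "i + m"] assms by simp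

text \<open>Two successive choices of \<open>j\<close> elements amount to one choice of
  \<open>2 * j\<close> elements followed by a split into halves; that choice is then exchanged with
  the choice of \<open>i\<close> elements.\<close>

lemma choose_trinomial:
  assumes "i + 2 * j \<le> n"
  shows "(n choose i) * ((n - i) choose j) * ((n - j - i) choose j)
    = (n choose (2 * j)) * ((2 * j) choose j) * ((n - 2 * j) choose i)"
proof -
  have "((n - i) choose j) * ((n - j - i) choose j) = ((n - i) choose (2 * j)) * ((2 * j) choose j)"
    using choose_mult[of j "2 * j" "n - i"] assms by (simp add: add.commute mult_2)
  then show ?thesis
    using choose_mult_swap[OF assms] by (metis mult.assoc mult.commute)
qed

lemma trinomial_sum:
  fixes x y z :: "'a :: comm_ring_1"
  shows "(\<Sum>i=0..n. \<Sum>j=0..(n - i) div 2.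
      of_nat (n choose i) * of_nat ((n - i) choose j) * of_nat ((n - j - i) choose j)
        * x ^ j * y ^ i * z ^ (n - 2 * j - i))
    = (\<Sum>k=0..n div 2.
        of_nat (n choose (2 * k)) * of_nat ((2 * k) choose k) * x ^ k * (y + z) ^ (n - 2 * k))"
    (is "?L = ?R")
proof -
  let ?f = "\<lambda>i j. of_nat (n choose (2 * j)) * of_nat ((2 * j) choose j) * x ^ j
    * (of_nat ((n - 2 * j) choose i) * y ^ i * z ^ (n - 2 * j - i))"
  have "?L = (\<Sum>i=0..n. \<Sum>j=0..(n - i) div 2. ?f i j)"
  proof (intro sum.cong refl)
    fix i j assume "i \<in> {0..n}" "j \<in> {0..(n - i) div 2}"
    then have "i + 2 * j \<le> n" by auto
    from arg_cong[OF choose_trinomial[OF this], of "of_nat :: nat \<Rightarrow> 'a"]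
    show "of_nat (n choose i) * of_nat ((n - i) choose j) * of_nat ((n - j - i) choose j)
        * x ^ j * y ^ i * z ^ (n - 2 * j - i) = ?f i j"
      by (simp add: ac_simps)
  qed
  \<comment> \<open>For \<open>i \<le> n\<close>, the bound \<open>j \<le> (n - i) div 2\<close>
    means \<open>i + 2 * j \<le> n\<close>. In this form the sums can be exchanged, and for fixed
    \<open>j\<close> the index \<open>i\<close> then runs over the full binomial expansion of
    \<open>(y + z) ^ (n - 2 * j)\<close>.\<close>
  also have "\<dots> = (\<Sum>i\<in>{0..n}. \<Sum>j\<in>{j \<in> {0..n div 2}. i + 2 * j \<le> n}. ?f i j)"
    by (intro sum.cong refl) auto
  also have "\<dots> = (\<Sum>j\<in>{0..n div 2}. \<Sum>i\<in>{i \<in> {0..n}. i + 2 * j \<le> n}. ?f i j)"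
    by (rule sum.swap_restrict) auto
  also have "\<dots> = (\<Sum>j\<in>{0..n div 2}. \<Sum>i\<le>n - 2 * j. ?f i j)"
    by (intro sum.cong refl) auto
  also have "\<dots> = ?R"
    by (simp add: binomial_ring sum_distrib_left)
  finally show ?thesis .
qed

lemma coeff_one_plus_monom_power:
  assumes "d > 0"
  shows "coeff ((1 + monom 1 d) ^ n :: 'a :: comm_semiring_1 poly) i
    = (if d dvd i then of_nat (n choose (i div d)) else 0)"
proof -
  have "coeff ((monom 1 d + 1) ^ n :: 'a poly) i
      = (\<Sum>k\<le>n. if d * k = i then of_nat (n choose k) else 0)"
    unfolding binomial_ring coeff_sum
    by (intro sum.cong refl) (simp add: monom_power of_nat_poly mult_monom flip: monom_0)
  also have "\<dots> = (if d dvd i then of_nat (n choose (i div d)) else 0)"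
  proof (cases "d dvd i")
    case True
    then have "d * k = i \<longleftrightarrow> k = i div d" for k using assms by auto
    \<comment> \<open>If \<open>i div d\<close> exceeds \<open>n\<close>, no index of the sum
      matches, and the binomial coefficient is 0 as well.\<close>
    then show ?thesis using True by (simp add: sum.delta binomial_eq_0)
  next
    case False
    then have "d * k \<noteq> i" for k by auto
    then show ?thesis using False by simp
  qed
  finally show ?thesis by (simp add: add.commute)
qed

lemma sum_even_index:
  fixes f :: "nat \<Rightarrow> 'a :: comm_monoid_add"
  assumes "\<And>j. odd j \<Longrightarrow> f j = 0"
  shows "(\<Sum>j\<le>m. f j) = (\<Sum>k=0..m div 2. f (2 * k))"
proof -
  have "(\<Sum>j\<le>m. f j) = sum f ((*) 2 ` {0..m div 2})"
    using assms by (intro sum.mono_neutral_right) (fastforce elim!: evenE)+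
  also have "\<dots> = (\<Sum>k=0..m div 2. f (2 * k))"
    by (subst sum.reindex) (auto simp: inj_on_def)
  finally show ?thesis .
qed

lemma central_binomial_sum:
  "(\<Sum>k=0..m div 2. (m choose (2 * k)) * ((2 * k) choose k) * 2 ^ (m - 2 * k)) = (2 * m) choose m"
proof -
  let ?t = "monom 1 1 :: nat poly"
  have "monom 2 1 = ?t + ?t"
    by (simp add: add_monom)
  then have "(1 + ?t)\<^sup>2 = (1 + monom 1 2) + monom 2 1"
    by (simp add: power2_eq_square algebra_simps mult_monom numeral_2_eq_2)
  then have "(1 + ?t) ^ (2 * m) = ((1 + monom 1 2) + monom 2 1) ^ m"
    by (simp add: power_mult)
  then have "(2 * m) choose m = coeff (((1 + monom 1 2) + monom 2 1) ^ m) m"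
    using coeff_one_plus_monom_power[of 1 "2 * m" m, where ?'a = nat] by simp
  \<comment> \<open>Here \<open>j\<close> of the \<open>m\<close> factors contribute
    \<open>1 + t^2\<close> and the others \<open>2t\<close>. The latter supply degree
    \<open>m - j\<close>, so \<open>t^j\<close> must come from \<open>(1 + t^2)^j\<close>; this
    forces \<open>j\<close> to be even.\<close>
  also have "\<dots> = (\<Sum>j\<le>m. coeff (monom ((m choose j) * 2 ^ (m - j)) (m - j) * (1 + monom 1 2) ^ j) m)"
    unfolding binomial_ring coeff_sum
    by (intro sum.cong refl)
      (simp add: monom_power of_nat_poly smult_monom ac_simps flip: mult_smult_left)
  also have "\<dots> = (\<Sum>j\<le>m. (m choose j) * 2 ^ (m - j) * (if even j then j choose (j div 2) else 0))"
    by (intro sum.cong refl) (simp add: coeff_monom_mult coeff_one_plus_monom_power del: One_nat_def)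
  also have "\<dots> = (\<Sum>k=0..m div 2. (m choose (2 * k)) * 2 ^ (m - 2 * k) * ((2 * k) choose k))"
    by (subst sum_even_index) auto
  finally show ?thesis by (simp add: ac_simps)
qed

text \<open>Expanding \<open>(u + 2 * x) ^ (n - 2 * k)\<close> and collecting by the total exponent
  \<open>m\<close> of \<open>x\<close> leaves, at \<open>x ^ m * u ^ (n - m)\<close>, the factor
  \<open>n choose m\<close> times the sum in \<open>central_binomial_sum\<close>.\<close>

lemma central_trinomial_sum:
  fixes x u :: "'a :: comm_ring_1"
  shows "(\<Sum>k=0..n div 2.
      of_nat (n choose (2 * k)) * of_nat ((2 * k) choose k) * x ^ (2 * k) * (u + 2 * x) ^ (n - 2 * k))
    = (\<Sum>k=0..n. of_nat (n choose k) * of_nat ((2 * k) choose k) * x ^ k * u ^ (n - k))"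
    (is "?L = ?R")
proof -
  \<comment> \<open>All numerical factors sit under one \<open>of_nat\<close>, so that the sum over
    \<open>k\<close> can be evaluated in the natural numbers.\<close>
  let ?f = "\<lambda>k m. of_nat ((n choose m) * ((m choose (2 * k)) * ((2 * k) choose k) * 2 ^ (m - 2 * k)))
    * (x ^ m * u ^ (n - m))"
  have "?L = (\<Sum>k=0..n div 2. \<Sum>m\<in>{2 * k..n}. ?f k m)"
  proof (intro sum.cong refl)
    fix k assume "k \<in> {0..n div 2}"
    then have k: "2 * k \<le> n" by auto
    let ?c = "of_nat (n choose (2 * k)) * of_nat ((2 * k) choose k) * x ^ (2 * k)"
    have "?c * (u + 2 * x) ^ (n - 2 * k)
        = (\<Sum>i=0..n - 2 * k. ?c * (of_nat ((n - 2 * k) choose i) * (2 * x) ^ i * u ^ (n - 2 * k - i)))"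
      by (simp add: add.commute[of u] binomial_ring sum_distrib_left atMost_atLeast0)
    also have "\<dots> = (\<Sum>i=0..n - 2 * k. ?f k (i + 2 * k))"
    proof (intro sum.cong refl)
      fix i assume "i \<in> {0..n - 2 * k}"
      then have "(n choose (2 * k)) * ((n - 2 * k) choose i)
          = (n choose (i + 2 * k)) * ((i + 2 * k) choose (2 * k))"
        using choose_mult[of "2 * k" "i + 2 * k" n] k by auto
      from arg_cong[OF this, of "of_nat :: nat \<Rightarrow> 'a"]
      have e: "of_nat (n choose (2 * k)) * of_nat ((n - 2 * k) choose i)
          = (of_nat (n choose (i + 2 * k)) * of_nat ((i + 2 * k) choose (2 * k)) :: 'a)"
        by simp
      have "?c * (of_nat ((n - 2 * k) choose i) * (2 * x) ^ i * u ^ (n - 2 * k - i))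
        = (of_nat (n choose (2 * k)) * of_nat ((n - 2 * k) choose i))
          * (of_nat ((2 * k) choose k) * 2 ^ i * (x ^ (i + 2 * k) * u ^ (n - (i + 2 * k))))"
        by (simp add: power_mult_distrib power_add ac_simps)
      also have "\<dots> = ?f k (i + 2 * k)"
        unfolding e by (simp add: ac_simps)
      finally show "?c * (of_nat ((n - 2 * k) choose i) * (2 * x) ^ i * u ^ (n - 2 * k - i))
        = ?f k (i + 2 * k)" .
    qed
    also have "\<dots> = (\<Sum>m\<in>{2 * k..n}. ?f k m)"
      using sum.shift_bounds_cl_nat_ivl[of "?f k" 0 "2 * k" "n - 2 * k"] k by simp
    finally show "?c * (u + 2 * x) ^ (n - 2 * k) = (\<Sum>m\<in>{2 * k..n}. ?f k m)" .
  qed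
  also have "\<dots> = (\<Sum>k\<in>{0..n div 2}. \<Sum>m\<in>{m \<in> {0..n}. 2 * k \<le> m}. ?f k m)"
    by (intro sum.cong refl) auto
  also have "\<dots> = (\<Sum>m\<in>{0..n}. \<Sum>k\<in>{k \<in> {0..n div 2}. 2 * k \<le> m}. ?f k m)"
    by (rule sum.swap_restrict) auto
  also have "\<dots> = (\<Sum>m\<in>{0..n}. \<Sum>k=0..m div 2. ?f k m)"
    by (intro sum.cong refl) auto
  also have "\<dots> = (\<Sum>m\<in>{0..n}. of_nat ((n choose m) * ((2 * m) choose m)) * (x ^ m * u ^ (n - m)))"
    by (simp only: central_binomial_sum flip: sum_distrib_right sum_distrib_left of_nat_sum)
  also have "\<dots> = ?R"
    by (simp add: ac_simps)
  finally show ?thesis .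
qed

theorem theorem2p5:
  fixes x y z :: "'a :: comm_ring_1" and n :: nat
  assumes "n \<ge> 1"
  shows "(\<Sum>i=0..n. \<Sum>j=0..(n - i) div 2.
            of_nat (n choose i) * of_nat ((n - i) choose j) * of_nat ((n - j - i) choose j)
              * x ^ j * y ^ i)
         = (\<Sum>k=0..n div 2.
            of_nat (n choose (2 * k)) * of_nat ((2 * k) choose k) * x ^ k * (1 + y) ^ (n - 2 * k))
       \<and> (\<Sum>i=0..n. \<Sum>j=0..(n - i) div 2.
            of_nat (n choose i) * of_nat ((n - i) choose j) * of_nat ((n - j - i) choose j)
              * x ^ (2 * j) * y ^ i * z ^ (n - 2 * j - i))
         = (\<Sum>k=0..n.
            of_nat (n choose k) * of_nat ((2 * k) choose k) * x ^ k * (y + z - 2 * x) ^ (n - k))"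
  \<comment> \<open>The value \<open>z = 1\<close> yields the first identity. Replacing
    \<open>x\<close> by its square produces the powers \<open>x ^ (2 * k)\<close>, and
    \<open>u = y + z - 2 * x\<close> makes \<open>u + 2 * x\<close> equal to
    \<open>y + z\<close>.\<close>
  using trinomial_sum[of n x y 1] trinomial_sum[of n "x\<^sup>2" y z]
    central_trinomial_sum[of n x "y + z - 2 * x"]
  by (simp add: add.commute[of y 1] flip: power_mult)

end
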